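(* Let $V$ be a vector space and $f:V\to V$ a linear endomorphism. 1. (a) The subspace $V$ generates the pre-Lie algebra $T_+(V,f)$ if, and only if, $f(V)=V$. (b) The subspace $V$ generates the Com-Pre-Lie algebra $T_+(V,f)$ if, and only if, the codimension of $f(V)$ in $V$ is $\le 1$. 2. Let $W$ be a subspace of $V$ and put $\overline{W}=\sum_{k=0}^\infty f^k(W)$, the smallest subspace of $V$ stable under $f$ which contains $W$. (a) $\mathbb{K}\emptyset\oplus W$ generates the pre-Lie algebra $T(V,f)$ if, and only if, $\overline{W}=V$ and $f(V)=V$. (b) $\mathbb{K}\emptyset\oplus W$ generates the Com-Pre-Lie algebra $T(V,f)$ if, and only if, $\overline{W}=V$ and the codimension of $f(V)$ in $V$ is $\le 1$.
   Context: $\mathbb{K}$ is a field of characteristic zero. For a vector space $V$, $T(V)=\bigoplus_{n\ge 0}V^{\otimes n}$ is spanned by words with letters in $V$; $\emptyset$ is the empty word; juxtaposition is concatenation; $T_+(V)=\bigoplus_{n\ge 1}V^{\otimes n}$. The shuffle product $\sqcup\!\sqcup$ is the bilinear product with unit $\emptyset$ and $xu\sqcup\!\sqcup yv=x(u\sqcup\!\sqcup yv)+y(xu\sqcup\!\sqcup v)$ for $x,y\in V$, $u,v\in T(V)$. The bilinear product $\bullet$ on $T(V)$ is defined by $\emptyset\bullet w'=0$ and $(xw)\bullet w'=x(w\bullet w')+f(x)(w\sqcup\!\sqcup w')$ for $x\in V$, $w,w'\in T(V)$. $T(V,f)$ is $T(V)$ with these products, and $T_+(V,f)$ is $T_+(V)$,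 which is stable under both products. These are Com-Pre-Lie algebras: $\sqcup\!\sqcup$ is commutative and associative, $\bullet$ is right pre-Lie, i.e. $(a\bullet b)\bullet c-a\bullet(b\bullet c)=(a\bullet c)\bullet b-a\bullet(c\bullet b)$, and $(a\sqcup\!\sqcup b)\bullet c=(a\bullet c)\sqcup\!\sqcup b+a\sqcup\!\sqcup(b\bullet c)$. "Generates the pre-Lie algebra" means using $\bullet$ (and linear combinations); "generates the Com-Pre-Lie algebra" means using $\sqcup\!\sqcup$ and $\bullet$. *)

theory Defs
  imports Complex_Main "HOL-Library.Poly_Mapping" "HOL-Library.Extended_Nat"
begin

section \<open>Formal linear combinations of words\<close>

text \<open>
  Throughout, \<open>s\<close> is the scalar multiplication of a vector space \<open>V\<close> carried by a whole type
  \<open>'v\<close>. A word is a list of vectors; \<open>'v list \<Rightarrow>\<^sub>0 'k\<close> is the space freely spanned by all words,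
  in which letters are not yet multilinear.
\<close>

definition pscale :: "'k::field \<Rightarrow> ('a \<Rightarrow>\<^sub>0 'k) \<Rightarrow> ('a \<Rightarrow>\<^sub>0 'k)"
  where "pscale c p = Poly_Mapping.map ((*) c) p"

lemma lookup_pscale [simp]: "Poly_Mapping.lookup (pscale c p) k = c * Poly_Mapping.lookup p k"
  unfolding pscale_def by transfer (simp add: when_def)

interpretation words: vector_space pscale
  by unfold_locales (auto intro!: poly_mapping_eqI simp: lookup_add algebra_simps)

definition lin_ext :: "('a \<Rightarrow> ('b \<Rightarrow>\<^sub>0 'k::field)) \<Rightarrow> ('a \<Rightarrow>\<^sub>0 'k) \<Rightarrow> ('b \<Rightarrow>\<^sub>0 'k)"
  where "lin_ext g p = (\<Sum>w\<in>Poly_Mapping.keys p. pscale (Poly_Mapping.lookup p w) (g w))"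

definition bilin_ext ::
    "('a \<Rightarrow> 'b \<Rightarrow> ('c \<Rightarrow>\<^sub>0 'k::field)) \<Rightarrow> ('a \<Rightarrow>\<^sub>0 'k) \<Rightarrow> ('b \<Rightarrow>\<^sub>0 'k) \<Rightarrow> ('c \<Rightarrow>\<^sub>0 'k)"
  where "bilin_ext g p q = lin_ext (\<lambda>u. lin_ext (g u) q) p"

definition prepend :: "'v \<Rightarrow> ('v list \<Rightarrow>\<^sub>0 'k::field) \<Rightarrow> ('v list \<Rightarrow>\<^sub>0 'k)"
  where "prepend x = lin_ext (\<lambda>w. Poly_Mapping.single (x # w) 1)"

fun shuffle_word :: "'v list \<Rightarrow> 'v list \<Rightarrow> ('v list \<Rightarrow>\<^sub>0 'k::field)" where
  "shuffle_word [] v = Poly_Mapping.single v 1"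
| "shuffle_word (x # u) [] = Poly_Mapping.single (x # u) 1"
| "shuffle_word (x # u) (y # v) =
     prepend x (shuffle_word u (y # v)) + prepend y (shuffle_word (x # u) v)"

fun bullet_word :: "('v \<Rightarrow> 'v) \<Rightarrow> 'v list \<Rightarrow> 'v list \<Rightarrow> ('v list \<Rightarrow>\<^sub>0 'k::field)" where
  "bullet_word f [] v = 0"
| "bullet_word f (x # u) v = prepend x (bullet_word f u v) + prepend (f x) (shuffle_word u v)"

section \<open>The tensor algebra\<close>

text \<open>
  \<open>T(V)\<close> is the quotient of the free space on words by the subspace expressing that words are
  multilinear in their letters. Its elements are the equivalence classes.
\<close>

definition tensor_relations :: "('k::field \<Rightarrow> 'v::ab_group_add \<Rightarrow> 'v) \<Rightarrow> ('v list \<Rightarrow>\<^sub>0 'k) set"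
  where "tensor_relations s = words.span
    {Poly_Mapping.single (u @ (s a x + s b y) # v) 1
       - Poly_Mapping.single (u @ x # v) a - Poly_Mapping.single (u @ y # v) b | u v x y a b. True}"

definition tensor_equiv ::
    "('k::field \<Rightarrow> 'v::ab_group_add \<Rightarrow> 'v) \<Rightarrow> (('v list \<Rightarrow>\<^sub>0 'k) \<times> ('v list \<Rightarrow>\<^sub>0 'k)) set"
  where "tensor_equiv s = {(p, q). p - q \<in> tensor_relations s}"

type_synonym ('v, 'k) tensor = "('v list \<Rightarrow>\<^sub>0 'k) set"

definition tensor_alg :: "('k::field \<Rightarrow> 'v::ab_group_add \<Rightarrow> 'v) \<Rightarrow> ('v, 'k) tensor set"
  where "tensor_alg s = UNIV // tensor_equiv s"

definition tensor_of ::
    "('k::field \<Rightarrow> 'v::ab_group_add \<Rightarrow> 'v) \<Rightarrow> ('v list \<Rightarrow>\<^sub>0 'k) \<Rightarrow> ('v, 'k) tensor"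
  where "tensor_of s p = tensor_equiv s `` {p}"

definition tensor_alg_plus :: "('k::field \<Rightarrow> 'v::ab_group_add \<Rightarrow> 'v) \<Rightarrow> ('v, 'k) tensor set"
  where "tensor_alg_plus s = {tensor_of s p | p. [] \<notin> Poly_Mapping.keys p}"

definition word :: "('k::field \<Rightarrow> 'v::ab_group_add \<Rightarrow> 'v) \<Rightarrow> 'v list \<Rightarrow> ('v, 'k) tensor"
  where "word s w = tensor_of s (Poly_Mapping.single w 1)"

definition tadd :: "('k::field \<Rightarrow> 'v::ab_group_add \<Rightarrow> 'v) \<Rightarrow>
    ('v, 'k) tensor \<Rightarrow> ('v, 'k) tensor \<Rightarrow> ('v, 'k) tensor"
  where "tadd s A B = (\<Union>p\<in>A. \<Union>q\<in>B. tensor_of s (p + q))"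

definition tscale :: "('k::field \<Rightarrow> 'v::ab_group_add \<Rightarrow> 'v) \<Rightarrow>
    'k \<Rightarrow> ('v, 'k) tensor \<Rightarrow> ('v, 'k) tensor"
  where "tscale s c A = (\<Union>p\<in>A. tensor_of s (pscale c p))"

definition tshuffle :: "('k::field \<Rightarrow> 'v::ab_group_add \<Rightarrow> 'v) \<Rightarrow>
    ('v, 'k) tensor \<Rightarrow> ('v, 'k) tensor \<Rightarrow> ('v, 'k) tensor"
  where "tshuffle s A B = (\<Union>p\<in>A. \<Union>q\<in>B. tensor_of s (bilin_ext shuffle_word p q))"

definition tbullet :: "('k::field \<Rightarrow> 'v::ab_group_add \<Rightarrow> 'v) \<Rightarrow> ('v \<Rightarrow> 'v) \<Rightarrow>
    ('v, 'k) tensor \<Rightarrow> ('v, 'k) tensor \<Rightarrow> ('v, 'k) tensor"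
  where "tbullet s f A B = (\<Union>p\<in>A. \<Union>q\<in>B. tensor_of s (bilin_ext (bullet_word f) p q))"

section \<open>Generated subalgebras\<close>

definition tensor_subspace ::
    "('k::field \<Rightarrow> 'v::ab_group_add \<Rightarrow> 'v) \<Rightarrow> ('v, 'k) tensor set \<Rightarrow> bool"
  where "tensor_subspace s S \<longleftrightarrow> S \<subseteq> tensor_alg s \<and> tensor_of s 0 \<in> S
    \<and> (\<forall>A\<in>S. \<forall>B\<in>S. tadd s A B \<in> S) \<and> (\<forall>c. \<forall>A\<in>S. tscale s c A \<in> S)"

definition prelie_subalgebra :: "('k::field \<Rightarrow> 'v::ab_group_add \<Rightarrow> 'v) \<Rightarrow> ('v \<Rightarrow> 'v) \<Rightarrow>
    ('v, 'k) tensor set \<Rightarrow> bool"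
  where "prelie_subalgebra s f S \<longleftrightarrow>
    tensor_subspace s S \<and> (\<forall>A\<in>S. \<forall>B\<in>S. tbullet s f A B \<in> S)"

definition com_prelie_subalgebra :: "('k::field \<Rightarrow> 'v::ab_group_add \<Rightarrow> 'v) \<Rightarrow> ('v \<Rightarrow> 'v) \<Rightarrow>
    ('v, 'k) tensor set \<Rightarrow> bool"
  where "com_prelie_subalgebra s f S \<longleftrightarrow>
    prelie_subalgebra s f S \<and> (\<forall>A\<in>S. \<forall>B\<in>S. tshuffle s A B \<in> S)"

definition generates_prelie :: "('k::field \<Rightarrow> 'v::ab_group_add \<Rightarrow> 'v) \<Rightarrow> ('v \<Rightarrow> 'v) \<Rightarrow>
    ('v, 'k) tensor set \<Rightarrow> ('v, 'k) tensor set \<Rightarrow> bool"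
  where "generates_prelie s f X S \<longleftrightarrow> prelie_subalgebra s f hull X = S"

definition generates_com_prelie :: "('k::field \<Rightarrow> 'v::ab_group_add \<Rightarrow> 'v) \<Rightarrow> ('v \<Rightarrow> 'v) \<Rightarrow>
    ('v, 'k) tensor set \<Rightarrow> ('v, 'k) tensor set \<Rightarrow> bool"
  where "generates_com_prelie s f X S \<longleftrightarrow> com_prelie_subalgebra s f hull X = S"

definition letters ::
    "('k::field \<Rightarrow> 'v::ab_group_add \<Rightarrow> 'v) \<Rightarrow> 'v set \<Rightarrow> ('v, 'k) tensor set"
  where "letters s W = {word s [x] | x. x \<in> W}"

definition unit_plus_letters ::
    "('k::field \<Rightarrow> 'v::ab_group_add \<Rightarrow> 'v) \<Rightarrow> 'v set \<Rightarrow> ('v, 'k) tensor set"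
  where "unit_plus_letters s W = {tadd s (tscale s c (word s [])) (word s [x]) | c x. x \<in> W}"

section \<open>Codimension and stable closure\<close>

text \<open>
  For a subspace \<open>U\<close>, the set \<open>B\<close> is mapped bijectively onto a basis of \<open>V/U\<close>.
\<close>

definition quotient_basis ::
    "('k::field \<Rightarrow> 'v::ab_group_add \<Rightarrow> 'v) \<Rightarrow> 'v set \<Rightarrow> 'v set \<Rightarrow> bool"
  where "quotient_basis s U B \<longleftrightarrow> \<not> module.dependent s B
    \<and> module.span s B \<inter> U = {0} \<and> module.span s (B \<union> U) = UNIV"

text \<open>
  All finite quotient bases have the same size, so the infimum picks the dimension of \<open>V/U\<close>;
  it is \<open>\<infinity>\<close> when there is none.
\<close>

definition codimension :: "('k::field \<Rightarrow> 'v::ab_group_add \<Rightarrow> 'v) \<Rightarrow> 'v set \<Rightarrow> enat"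
  where "codimension s U = Inf {enat (card B) | B. finite B \<and> quotient_basis s U B}"

definition stable_closure ::
    "('k::field \<Rightarrow> 'v::ab_group_add \<Rightarrow> 'v) \<Rightarrow> ('v \<Rightarrow> 'v) \<Rightarrow> 'v set \<Rightarrow> 'v set"
  where "stable_closure s f W = module.span s (\<Union>k. (f ^^ k) ` W)"

section \<open>Well-definedness of the operations\<close>

lemma lin_ext_superset:
  assumes "finite A" "Poly_Mapping.keys p \<subseteq> A"
  shows "lin_ext g p = (\<Sum>w\<in>A. pscale (Poly_Mapping.lookup p w) (g w))"
  unfolding lin_ext_def using assms
  by (intro sum.mono_neutral_left) (auto simp: in_keys_iff)

lemma lin_ext_add: "lin_ext g (p + q) = lin_ext g p + lin_ext g q"
proof -
  let ?A = "Poly_Mapping.keys p \<union> Poly_Mapping.keys q"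
  have "Poly_Mapping.keys (p + q) \<subseteq> ?A" by (rule Poly_Mapping.keys_add)
  then show ?thesis
    by (simp add: lin_ext_superset[of ?A] lookup_add words.scale_left_distrib sum.distrib)
qed

lemma lin_ext_scale: "lin_ext g (pscale c p) = pscale c (lin_ext g p)"
proof -
  let ?A = "Poly_Mapping.keys p"
  have "Poly_Mapping.keys (pscale c p) \<subseteq> ?A" by (auto simp: in_keys_iff)
  then show ?thesis by (simp add: lin_ext_superset[of ?A] words.scale_sum_right)
qed

lemma lin_ext_diff: "lin_ext g (p - q) = lin_ext g p - lin_ext g q"
  using lin_ext_add[of g "p - q" q] by simp

lemma lin_ext_zero [simp]: "lin_ext g 0 = 0"
  by (simp add: lin_ext_def)

lemma lin_ext_single [simp]: "lin_ext g (Poly_Mapping.single w c) = pscale c (g w)"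
  by (subst lin_ext_superset[of "{w}"]) (auto simp: lookup_single)

lemma pscale_single [simp]: "pscale c (Poly_Mapping.single w d) = Poly_Mapping.single w (c * d)"
  by (rule poly_mapping_eqI) (auto simp: lookup_single when_def)

lemma subspace_tensor_relations: "words.subspace (tensor_relations s)"
  unfolding tensor_relations_def by (rule words.subspace_span)

lemmas tensor_relations_closed =
  words.subspace_0[OF subspace_tensor_relations]
  words.subspace_add[OF subspace_tensor_relations]
  words.subspace_diff[OF subspace_tensor_relations]
  words.subspace_scale[OF subspace_tensor_relations]

lemma lin_ext_sub: "lin_ext (\<lambda>w. g w - h w) p = lin_ext g p - lin_ext h p"
  by (simp add: lin_ext_def words.scale_right_diff_distrib sum_subtractf)

lemma lin_ext_pscale: "lin_ext (\<lambda>w. pscale c (g w)) p = pscale c (lin_ext g p)"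
  by (simp add: lin_ext_def words.scale_sum_right mult.commute)

lemma lin_ext_in_relations:
  assumes "\<And>w. g w \<in> tensor_relations s"
  shows "lin_ext g p \<in> tensor_relations s"
  unfolding lin_ext_def
  by (intro words.subspace_sum subspace_tensor_relations tensor_relations_closed assms)

definition word_multilinear :: "('k::field \<Rightarrow> 'v::ab_group_add \<Rightarrow> 'v) \<Rightarrow>
    ('v list \<Rightarrow> ('v list \<Rightarrow>\<^sub>0 'k)) \<Rightarrow> bool"
  where "word_multilinear s g \<longleftrightarrow> (\<forall>u v x y a b.
    g (u @ (s a x + s b y) # v) - pscale a (g (u @ x # v)) - pscale b (g (u @ y # v))
      \<in> tensor_relations s)"

lemma lin_ext_relations:
  assumes "word_multilinear s g" "p \<in> tensor_relations s"
  shows "lin_ext g p \<in> tensor_relations s"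
  using assms(2) unfolding tensor_relations_def[of s]
proof (induction rule: words.span_induct_alt)
  case base
  show ?case by (simp add: words.span_zero)
next
  case (step c x y)
  have "lin_ext g x \<in> tensor_relations s"
    using step(1) assms(1) by (auto simp: lin_ext_diff word_multilinear_def)
  then show ?case
    using step(2)
    by (simp add: lin_ext_add lin_ext_scale tensor_relations_def words.span_add words.span_scale)
qed

lemma word_multilinear_prepend: "word_multilinear s (\<lambda>w. Poly_Mapping.single (x # w) 1)"
  unfolding word_multilinear_def
proof (intro allI)
  fix u v y z a b
  show "Poly_Mapping.single (x # u @ (s a y + s b z) # v) 1
      - pscale a (Poly_Mapping.single (x # u @ y # v) 1)
      - pscale b (Poly_Mapping.single (x # u @ z # v) 1) \<in> tensor_relations s"
    unfolding tensor_relations_def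
    by (rule words.span_base, simp) (metis append_Cons)
qed

lemma prepend_relations: "p \<in> tensor_relations s \<Longrightarrow> prepend x p \<in> tensor_relations s"
  unfolding prepend_def by (rule lin_ext_relations[OF word_multilinear_prepend])

lemma prepend_linear:
  "prepend (s a x + s b y) p - pscale a (prepend x p) - pscale b (prepend y p)
     \<in> tensor_relations s"
proof -
  have "Poly_Mapping.single ((s a x + s b y) # w) 1 - pscale a (Poly_Mapping.single (x # w) 1)
      - pscale b (Poly_Mapping.single (y # w) 1) \<in> tensor_relations s" for w
    unfolding tensor_relations_def
    by (rule words.span_base, simp) (metis append_Nil)
  then show ?thesis
    unfolding prepend_def lin_ext_pscale[symmetric] lin_ext_sub[symmetric]
    by (rule lin_ext_in_relations)
qed

lemma prepend_add: "prepend x (p + q) = prepend x p + prepend x q"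
  and prepend_diff: "prepend x (p - q) = prepend x p - prepend x q"
  and prepend_scale: "prepend x (pscale c p) = pscale c (prepend x p)"
  by (simp_all add: prepend_def lin_ext_add lin_ext_diff lin_ext_scale)

lemma shuffle_word_Nil_right [simp]: "shuffle_word u [] = Poly_Mapping.single u 1"
  by (cases u) auto

lemma shuffle_word_commute: "shuffle_word u v = shuffle_word v u"
  by (induction u v rule: shuffle_word.induct) (auto simp: add.commute)

lemma single_in_relations:
  "Poly_Mapping.single (u @ (s a x + s b y) # v) 1
     - Poly_Mapping.single (u @ x # v) a - Poly_Mapping.single (u @ y # v) b \<in> tensor_relations s"
  unfolding tensor_relations_def by (rule words.span_base) blast

lemma word_multilinear_shuffle_left: "word_multilinear s (\<lambda>u. shuffle_word u v)"
  unfolding word_multilinear_def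
proof (intro allI)
  fix u u' x y a b
  let ?D = "\<lambda>u v. shuffle_word (u @ (s a x + s b y) # u') v
      - pscale a (shuffle_word (u @ x # u') v) - pscale b (shuffle_word (u @ y # u') v)"
  show "?D u v \<in> tensor_relations s"
  proof (induction "length u + length v" arbitrary: u v rule: less_induct)
    case less
    show ?case
    proof (cases v)
      case Nil
      then show ?thesis using single_in_relations[of u s a x b y u'] by simp
    next
      case v: (Cons z v')
      have IH: "prepend z (?D u v') \<in> tensor_relations s"
        using less[of u v'] v by (intro prepend_relations) simp
      show ?thesis
      proof (cases u)
        case Nil
        show ?thesis
          using tensor_relations_closed(2)[OF IH
              prepend_linear[of s a x b y "shuffle_word u' v"]]
          by (simp add: Nil v prepend_add prepend_diff prepend_scale words.scale_right_distrib algebra_simps)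
      next
        case u: (Cons t u2)
        have "prepend t (?D u2 v) \<in> tensor_relations s"
          using less[of u2 v] u by (intro prepend_relations) simp
        from tensor_relations_closed(2)[OF IH this] show ?thesis
          by (simp add: u v prepend_add prepend_diff prepend_scale words.scale_right_distrib algebra_simps)
      qed
    qed
  qed
qed

lemma word_multilinear_shuffle_right:
  fixes s :: "'k::field \<Rightarrow> 'v::ab_group_add \<Rightarrow> 'v"
  shows "word_multilinear s (shuffle_word u)"
proof -
  have "shuffle_word u = (\<lambda>v. shuffle_word v u :: 'v list \<Rightarrow>\<^sub>0 'k)"
    by (rule ext) (rule shuffle_word_commute)
  then show ?thesis using word_multilinear_shuffle_left[of s u] by simp
qed

lemma word_multilinear_bullet_right: "word_multilinear s (bullet_word f u)"
  unfolding word_multilinear_def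
proof (intro allI)
  fix v v' x y a b
  let ?D = "\<lambda>g. g (v @ (s a x + s b y) # v')
      - pscale a (g (v @ x # v')) - pscale b (g (v @ y # v'))"
  show "?D (bullet_word f u) \<in> tensor_relations s"
  proof (induction u)
    case Nil
    show ?case by (simp add: tensor_relations_closed)
  next
    case (Cons t u)
    have "?D (shuffle_word u) \<in> tensor_relations s"
      using word_multilinear_shuffle_right unfolding word_multilinear_def by blast
    from tensor_relations_closed(2)[OF prepend_relations[OF Cons, of t]
        prepend_relations[OF this, of "f t"]]
    show ?case by (simp add: prepend_add prepend_diff prepend_scale words.scale_right_distrib algebra_simps)
  qed
qed

lemma word_multilinear_bullet_left:
  assumes "Vector_Spaces.linear s s f"
  shows "word_multilinear s (\<lambda>u. bullet_word f u v)"
  unfolding word_multilinear_def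
proof (intro allI)
  interpret f: Vector_Spaces.linear s s f by fact
  fix u u' x y a b
  let ?D = "\<lambda>g u. g (u @ (s a x + s b y) # u')
      - pscale a (g (u @ x # u')) - pscale b (g (u @ y # u'))"
  show "?D (\<lambda>u. bullet_word f u v) u \<in> tensor_relations s"
  proof (induction u)
    case Nil
    show ?case
      using tensor_relations_closed(2)[OF prepend_linear[of s a x b y "bullet_word f u' v"]
          prepend_linear[of s a "f x" b "f y" "shuffle_word u' v"]]
      by (simp add: f.add f.scale words.scale_right_distrib algebra_simps)
  next
    case (Cons t u)
    have "?D (\<lambda>u. shuffle_word u v) u \<in> tensor_relations s"
      using word_multilinear_shuffle_left unfolding word_multilinear_def by blast
    from tensor_relations_closed(2)[OF prepend_relations[OF Cons, of t]
        prepend_relations[OF this, of "f t"]]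
    show ?case by (simp add: prepend_add prepend_diff prepend_scale words.scale_right_distrib algebra_simps)
  qed
qed

lemma equiv_tensor_equiv: "equiv UNIV (tensor_equiv s)"
proof (rule equivI)
  show "refl (tensor_equiv s)"
    by (auto simp: refl_on_def tensor_equiv_def tensor_relations_closed)
  show "sym (tensor_equiv s)"
    using tensor_relations_closed(3)[OF tensor_relations_closed(1)]
    by (fastforce simp: sym_def tensor_equiv_def)
  show "trans (tensor_equiv s)"
    using tensor_relations_closed(2) by (fastforce simp: trans_def tensor_equiv_def)
qed auto

lemma tensor_of_eq_iff: "tensor_of s p = tensor_of s q \<longleftrightarrow> p - q \<in> tensor_relations s"
  using eq_equiv_class_iff[OF equiv_tensor_equiv, of p q s]
  by (simp add: tensor_of_def) (simp add: tensor_equiv_def)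

lemma tensor_alg_eq: "tensor_alg s = range (tensor_of s)"
  by (auto simp: tensor_alg_def quotient_def tensor_of_def)

lemma self_in_tensor_of: "p \<in> tensor_of s p"
  using equiv_class_self[OF equiv_tensor_equiv, of p s] by (simp add: tensor_of_def)

lemma mem_tensor_ofD: "q \<in> tensor_of s p \<Longrightarrow> p - q \<in> tensor_relations s"
  by (auto simp: tensor_of_def tensor_equiv_def)

lemma lift_binary:
  assumes "\<And>p' q'. p - p' \<in> tensor_relations s \<Longrightarrow> q - q' \<in> tensor_relations s \<Longrightarrow>
      g p q - g p' q' \<in> tensor_relations s"
  shows "(\<Union>p\<in>tensor_of s p. \<Union>q\<in>tensor_of s q. tensor_of s (g p q)) = tensor_of s (g p q)"
proof -
  have "tensor_of s (g p' q') = tensor_of s (g p q)"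
    if "p' \<in> tensor_of s p" "q' \<in> tensor_of s q" for p' q'
    using assms[OF mem_tensor_ofD[OF that(1)] mem_tensor_ofD[OF that(2)]]
    by (metis tensor_of_eq_iff)
  moreover have "p \<in> tensor_of s p" "q \<in> tensor_of s q"
    by (rule self_in_tensor_of)+
  ultimately show ?thesis by blast
qed

lemma tadd_tensor_of: "tadd s (tensor_of s p) (tensor_of s q) = tensor_of s (p + q)"
  unfolding tadd_def
proof (rule lift_binary)
  fix p' q'
  assume "p - p' \<in> tensor_relations s" "q - q' \<in> tensor_relations s"
  from tensor_relations_closed(2)[OF this]
  show "p + q - (p' + q') \<in> tensor_relations s" by (simp add: algebra_simps)
qed

lemma tscale_tensor_of: "tscale s c (tensor_of s p) = tensor_of s (pscale c p)"
proof -
  have "tensor_of s (pscale c p') = tensor_of s (pscale c p)" if "p' \<in> tensor_of s p" for p'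
    using tensor_relations_closed(4)[OF mem_tensor_ofD[OF that], of c]
    by (metis tensor_of_eq_iff words.scale_right_diff_distrib)
  then show ?thesis unfolding tscale_def using self_in_tensor_of by blast
qed

lemma bilin_ext_congruent:
  assumes "\<And>v. word_multilinear s (\<lambda>u. g u v)" "\<And>u. word_multilinear s (g u)"
    and "p - p' \<in> tensor_relations s" "q - q' \<in> tensor_relations s"
  shows "bilin_ext g p q - bilin_ext g p' q' \<in> tensor_relations s"
proof -
  have swap: "word_multilinear s (\<lambda>u. lin_ext (g u) q)"
    using assms(1) unfolding word_multilinear_def lin_ext_pscale[symmetric] lin_ext_sub[symmetric]
    by (auto intro!: lin_ext_in_relations)
  have 1: "bilin_ext g (p - p') q \<in> tensor_relations s"
    unfolding bilin_ext_def by (rule lin_ext_relations[OF swap assms(3)])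
  have 2: "bilin_ext g p' (q - q') \<in> tensor_relations s"
    unfolding bilin_ext_def
    by (rule lin_ext_in_relations, rule lin_ext_relations[OF assms(2,4)])
  have "bilin_ext g p q - bilin_ext g p' q' = bilin_ext g (p - p') q + bilin_ext g p' (q - q')"
    by (simp add: bilin_ext_def lin_ext_diff lin_ext_sub)
  then show ?thesis using tensor_relations_closed(2)[OF 1 2] by simp
qed

lemma tshuffle_tensor_of:
  "tshuffle s (tensor_of s p) (tensor_of s q) = tensor_of s (bilin_ext shuffle_word p q)"
  unfolding tshuffle_def
  by (rule lift_binary, rule bilin_ext_congruent)
    (auto intro: word_multilinear_shuffle_left word_multilinear_shuffle_right)

lemma tbullet_tensor_of:
  assumes "Vector_Spaces.linear s s f"
  shows "tbullet s f (tensor_of s p) (tensor_of s q) = tensor_of s (bilin_ext (bullet_word f) p q)"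
  unfolding tbullet_def
  by (rule lift_binary, rule bilin_ext_congruent)
    (auto intro: word_multilinear_bullet_left[OF assms] word_multilinear_bullet_right)

end

theory Submission
  imports Defs
begin

text \<open>
  A generation claim fails as soon as some proper subalgebra contains the generators, so each
  necessary condition asks for a subalgebra, and each such subalgebra is found as a common kernel
  of linear forms on \<open>T(V)\<close> that see only words of length one or two. Write \<open>\<epsilon>\<close> for the counit,
  the coefficient of the empty word.

  \<^item> If \<open>\<phi>\<close> is a linear form on \<open>V\<close> vanishing on \<open>f(V)\<close>, the form \<open>xy \<mapsto> \<phi>(x)\<phi>(y)\<close> on words of
    length two kills every product \<open>a \<bullet> b\<close>: in degree two these are combinations of \<open>f(x)y\<close> and
    \<open>x f(y)\<close>. Hence \<open>V\<close> and the empty word never produce \<open>zz\<close> when \<open>\<phi>(z) = 1\<close>.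

  \<^item> If the codimension exceeds one, there are two independent forms \<open>\<phi>\<close> and \<open>\<psi>\<close> vanishing on
    \<open>f(V)\<close>, and \<open>L(xy) = \<phi>(x)\<psi>(y) - \<psi>(x)\<phi>(y)\<close> kills moreover \<open>xy + yx\<close>. Thus
    \<open>L(a \<squnion> b) = \<epsilon>(a) L(b) + L(a) \<epsilon>(b)\<close> for the shuffle product \<open>\<squnion>\<close>, and the kernel of \<open>L\<close> is
    closed under both products.

  \<^item> A linear form \<open>\<phi>\<close> on letters satisfies \<open>\<phi>(a \<bullet> b) = (\<phi> \<circ> f)(a) \<epsilon>(b)\<close>, so the tensors whose part
    of degree one lies in an \<open>f\<close>-stable subspace form a subalgebra. This forces the stable closure
    of \<open>W\<close> to be \<open>V\<close>.

  For the sufficient conditions, \<open>x \<bullet> w = f(x) w\<close>. When \<open>f\<close> is onto this builds all nonempty words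
  letter by letter. When \<open>V\<close> is spanned by \<open>f(V)\<close> and one vector \<open>z\<close>, it yields the words starting
  with a letter of \<open>f(V)\<close>, and the leading powers of \<open>z\<close> come from the shuffle identity
  \<open>z \<squnion> z^k y w = (k+1) z^{k+1} y w + z^k y (z \<squnion> w)\<close>,
  in which \<open>k + 1\<close> is invertible in characteristic zero: induction on \<open>k\<close> reaches all words
  \<open>z^k y w\<close> with \<open>y \<in> f(V)\<close>, and \<open>z \<squnion> z^k = (k+1) z^{k+1}\<close> reaches the pure powers. Finally
  \<open>x \<bullet> \<emptyset> = f(x)\<close>, so the empty word and \<open>W\<close> generate all letters of the stable closure of \<open>W\<close>.

  The two directions are \<open>proper_prelie_subalgebra\<close>, \<open>proper_com_prelie_subalgebra\<close> and
  \<open>proper_subalgebra_stable_closure\<close> on the one hand, \<open>words_in_prelie_subalgebra\<close>,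
  \<open>words_in_com_prelie_subalgebra\<close> and \<open>unit_and_letters_in_prelie_subalgebra\<close> on the other.
\<close>

section \<open>Functionals on words\<close>

definition functional :: "('a \<Rightarrow> 'k::field) \<Rightarrow> ('a \<Rightarrow>\<^sub>0 'k) \<Rightarrow> 'k"
  where "functional l p = (\<Sum>w\<in>Poly_Mapping.keys p. Poly_Mapping.lookup p w * l w)"

lemma functional_superset:
  assumes "finite A" "Poly_Mapping.keys p \<subseteq> A"
  shows "functional l p = (\<Sum>w\<in>A. Poly_Mapping.lookup p w * l w)"
  unfolding functional_def using assms
  by (intro sum.mono_neutral_left) (auto simp: in_keys_iff)

lemma functional_add: "functional l (p + q) = functional l p + functional l q"
proof -
  let ?A = "Poly_Mapping.keys p \<union> Poly_Mapping.keys q"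
  have "Poly_Mapping.keys (p + q) \<subseteq> ?A" by (rule Poly_Mapping.keys_add)
  then show ?thesis
    by (simp add: functional_superset[of ?A] lookup_add distrib_right sum.distrib)
qed

lemma functional_pscale: "functional l (pscale c p) = c * functional l p"
proof -
  let ?A = "Poly_Mapping.keys p"
  have "Poly_Mapping.keys (pscale c p) \<subseteq> ?A" by (auto simp: in_keys_iff)
  then show ?thesis by (simp add: functional_superset[of ?A] sum_distrib_left mult.assoc)
qed

lemma functional_diff: "functional l (p - q) = functional l p - functional l q"
  using functional_add[of l "p - q" q] by simp

lemma functional_zero [simp]: "functional l 0 = 0"
  by (simp add: functional_def)

lemma functional_single [simp]: "functional l (Poly_Mapping.single w c) = c * l w"
  by (subst functional_superset[of "{w}"]) (auto simp: lookup_single)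

lemma functional_sum: "functional l (\<Sum>i\<in>I. g i) = (\<Sum>i\<in>I. functional l (g i))"
  by (induction I rule: infinite_finite_induct) (auto simp: functional_add)

lemma functional_lin_ext:
  "functional l (lin_ext g p) = functional (\<lambda>w. functional l (g w)) p"
  unfolding lin_ext_def functional_sum functional_pscale
  by (simp add: functional_def)

lemma functional_times: "functional (\<lambda>w. c * l w) p = c * functional l p"
  by (simp add: functional_def sum_distrib_left mult_ac)

lemma functional_plus: "functional (\<lambda>w. l w + m w) p = functional l p + functional m p"
  by (simp add: functional_def distrib_left sum.distrib)

lemma functional_const_0 [simp]: "functional (\<lambda>w. 0) p = 0"
  by (simp add: functional_def)

text \<open>
  Every form of low degree used below takes a product of words to such a sum of at most two rank-one
  terms; bilinearity carries the equality over to arbitrary combinations of words, where vanishing on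
  a product is read off from the factors.
\<close>

lemma functional_bilin_ext:
  assumes "\<And>u v. functional l (g u v) = a u * b v + c u * d v"
  shows "functional l (bilin_ext g p q)
    = functional a p * functional b q + functional c p * functional d q"
  by (simp add: bilin_ext_def functional_lin_ext assms functional_plus functional_times
      mult.commute[of _ "functional _ q"])

lemma functional_prepend:
  "functional l (prepend x p) = functional (\<lambda>w. l (x # w)) p"
  by (simp add: prepend_def functional_lin_ext)

section \<open>Forms of low degree\<close>

definition counit :: "'v list \<Rightarrow> 'k::field"
  where "counit w = (if w = [] then 1 else 0)"

definition letter_form :: "('v \<Rightarrow> 'k::field) \<Rightarrow> 'v list \<Rightarrow> 'k"
  where "letter_form \<phi> w = (case w of [x] \<Rightarrow> \<phi> x | _ \<Rightarrow> 0)"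

definition pair_form :: "('v \<Rightarrow> 'v \<Rightarrow> 'k::field) \<Rightarrow> 'v list \<Rightarrow> 'k"
  where "pair_form \<beta> w = (case w of [x, y] \<Rightarrow> \<beta> x y | _ \<Rightarrow> 0)"

lemma counit_simps [simp]: "counit [] = 1" "counit (x # w) = 0"
  by (simp_all add: counit_def)

lemma letter_form_simps [simp]: "letter_form \<phi> [] = 0" "letter_form \<phi> (x # w) = \<phi> x * counit w"
  by (simp_all add: letter_form_def counit_def split: list.split)

lemma pair_form_simps [simp]:
  "pair_form \<beta> [] = 0" "pair_form \<beta> (x # w) = letter_form (\<beta> x) w"
  by (simp_all add: letter_form_def pair_form_def split: list.split)

lemma functional_counit: "functional counit p = Poly_Mapping.lookup p []"
  by (subst functional_superset[of "insert [] (Poly_Mapping.keys p)"])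
    (auto simp: counit_def sum.insert_remove)

lemmas functional_degree =
  functional_add functional_prepend functional_times functional_plus

lemma counit_shuffle: "functional counit (shuffle_word u v) = counit u * counit v"
  by (cases "(u, v)" rule: shuffle_word.cases) (simp_all add: functional_degree)

text \<open>
  The shuffle of two nonempty words has length at least two, so only products with the empty word
  reach degree one.
\<close>

lemma letter_form_shuffle:
  "functional (letter_form \<phi>) (shuffle_word u v)
    = counit u * letter_form \<phi> v + letter_form \<phi> u * counit v"
  by (cases "(u, v)" rule: shuffle_word.cases)
    (simp_all add: functional_degree counit_shuffle)

text \<open>
  In degree two the only products of nonempty words are \<open>xy + yx\<close>, which an alternating form kills.
\<close>

lemma pair_form_shuffle:
  assumes "\<And>x y. \<beta> x y + \<beta> y x = 0"
  shows "functional (pair_form \<beta>) (shuffle_word u v)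
    = counit u * pair_form \<beta> v + pair_form \<beta> u * counit v"
proof (cases "(u, v)" rule: shuffle_word.cases)
  case (3 x u' y v')
  have "\<beta> y x = - \<beta> x y" using assms[of x y] by (simp add: add_eq_0_iff)
  with 3 show ?thesis
    by (simp add: functional_degree letter_form_shuffle)
qed simp_all

lemma counit_bullet: "functional counit (bullet_word f u v) = 0"
  by (cases u) (simp_all add: functional_degree)

lemma letter_form_bullet:
  "functional (letter_form \<phi>) (bullet_word f u v) = letter_form (\<lambda>x. \<phi> (f x)) u * counit v"
  by (cases u) (simp_all add: functional_degree counit_shuffle counit_bullet)

text \<open>
  The products of degree two are \<open>f(x) y\<close>, from two letters, and \<open>f(x) y + x f(y)\<close>, from \<open>xy\<close> and
  the empty word.
\<close>

lemma pair_form_bullet: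
  fixes \<beta> :: "'v \<Rightarrow> 'v \<Rightarrow> 'k::field"
  assumes "\<And>x y. \<beta> (f x) y = 0" "\<And>x y. \<beta> x (f y) = 0"
  shows "functional (pair_form \<beta>) (bullet_word f u v) = 0"
proof -
  have "letter_form (\<lambda>_. 0) w = (0 :: 'k)" for w :: "'v list" by (cases w) simp_all
  moreover have "\<beta> (f x) = (\<lambda>_. 0)" for x using assms(1) by blast
  ultimately show ?thesis
    using assms by (cases u) (simp_all add: functional_degree letter_form_shuffle letter_form_bullet)
qed

section \<open>Subalgebras cut out by functionals\<close>

definition multilinear_form ::
    "('k::field \<Rightarrow> 'v::ab_group_add \<Rightarrow> 'v) \<Rightarrow> ('v list \<Rightarrow> 'k) \<Rightarrow> bool"
  where "multilinear_form s l \<longleftrightarrow> (\<forall>u v x y a b.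
    l (u @ (s a x + s b y) # v) = a * l (u @ x # v) + b * l (u @ y # v))"

lemma functional_relations:
  assumes "multilinear_form s l" "p \<in> tensor_relations s"
  shows "functional l p = 0"
  using assms(2) unfolding tensor_relations_def
proof (induction rule: words.span_induct_alt)
  case (step c x y)
  then show ?case
    using assms(1)
    by (auto simp: functional_add functional_pscale functional_diff multilinear_form_def)
qed simp

lemma multilinear_letter_form:
  assumes "\<And>x y a b. \<phi> (s a x + s b y) = a * \<phi> x + b * \<phi> y"
  shows "multilinear_form s (letter_form \<phi>)"
  unfolding multilinear_form_def
proof (intro allI)
  fix u v x y a b
  show "letter_form \<phi> (u @ (s a x + s b y) # v)
      = a * letter_form \<phi> (u @ x # v) + b * letter_form \<phi> (u @ y # v)"
    by (cases u) (simp_all add: assms counit_def algebra_simps)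
qed

lemma multilinear_pair_form:
  assumes "\<And>x y z a b. \<beta> (s a x + s b y) z = a * \<beta> x z + b * \<beta> y z"
    and "\<And>x y z a b. \<beta> z (s a x + s b y) = a * \<beta> z x + b * \<beta> z y"
  shows "multilinear_form s (pair_form \<beta>)"
  unfolding multilinear_form_def
proof (intro allI)
  fix u v x y a b
  show "pair_form \<beta> (u @ (s a x + s b y) # v)
      = a * pair_form \<beta> (u @ x # v) + b * pair_form \<beta> (u @ y # v)"
  proof (cases u)
    case Nil
    then show ?thesis by (cases v) (simp_all add: assms algebra_simps)
  next
    case (Cons t u')
    have "multilinear_form s (letter_form (\<beta> t))"
      using assms(2) by (rule multilinear_letter_form)
    with Cons show ?thesis by (simp add: multilinear_form_def)
  qed
qed

text \<open>
  A tensor qualifies when some representative is killed; for multilinear forms this does not depend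
  on the representative.
\<close>

definition annihilator ::
    "('k::field \<Rightarrow> 'v::ab_group_add \<Rightarrow> 'v) \<Rightarrow> ('v list \<Rightarrow> 'k) set \<Rightarrow> ('v, 'k) tensor set"
  where "annihilator s L = tensor_of s ` {p. \<forall>l\<in>L. functional l p = 0}"

lemma tensor_of_in_annihilator_iff:
  assumes "\<And>l. l \<in> L \<Longrightarrow> multilinear_form s l"
  shows "tensor_of s p \<in> annihilator s L \<longleftrightarrow> (\<forall>l\<in>L. functional l p = 0)"
proof
  assume "tensor_of s p \<in> annihilator s L"
  then obtain q where q: "tensor_of s p = tensor_of s q" "\<forall>l\<in>L. functional l q = 0"
    by (auto simp: annihilator_def)
  then have "p - q \<in> tensor_relations s" by (simp add: tensor_of_eq_iff)
  with assms q(2) show "\<forall>l\<in>L. functional l p = 0"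
    using functional_relations by (fastforce simp: functional_diff)
qed (auto simp: annihilator_def)

lemma tensor_subspace_annihilator: "tensor_subspace s (annihilator s L)"
  by (auto simp: tensor_subspace_def annihilator_def tensor_alg_eq tadd_tensor_of
      tscale_tensor_of functional_add functional_pscale intro!: imageI)

text \<open>
  The set \<open>L\<close> need only be stable under the transformation \<open>l \<mapsto> l'\<close> induced by \<open>\<bullet>\<close>, up to the zero
  form. The zero form handles the pair forms that vanish on every product \<open>a \<bullet> b\<close>; the
  general case handles letter forms, where \<open>l'\<close> is \<open>l\<close> precomposed with \<open>f\<close>.
\<close>

lemma prelie_subalgebra_annihilator:
  assumes "Vector_Spaces.linear s s f"
    and "\<And>l. l \<in> L \<Longrightarrow>
      \<exists>l'\<in>insert (\<lambda>_. 0) L. \<forall>u v. functional l (bullet_word f u v) = l' u * counit v"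
  shows "prelie_subalgebra s f (annihilator s L)"
proof -
  have "functional l (bilin_ext (bullet_word f) p q) = 0"
    if "l \<in> L" and p: "\<forall>l\<in>L. functional l p = 0" for l p q
  proof -
    obtain l' where l': "l' \<in> insert (\<lambda>_. 0) L"
        "\<And>u v. functional l (bullet_word f u v) = l' u * counit v"
      using assms(2)[OF \<open>l \<in> L\<close>] by blast
    have "functional l (bilin_ext (bullet_word f) p q) = functional l' p * functional counit q"
      using functional_bilin_ext[of l "bullet_word f" l' counit "\<lambda>_. 0" "\<lambda>_. 0"] l'(2) by simp
    then show ?thesis using l'(1) p by auto
  qed
  then show ?thesis
    unfolding prelie_subalgebra_def
    by (auto simp: tensor_subspace_annihilator)
      (auto simp: annihilator_def tbullet_tensor_of[OF assms(1)] intro!: imageI)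
qed

text \<open>
  Forms that act as derivations over the counit vanish on a shuffle product as soon as they vanish on
  both factors.
\<close>

lemma com_prelie_subalgebra_annihilator:
  assumes "prelie_subalgebra s f (annihilator s L)"
    and "\<And>l u v. l \<in> L \<Longrightarrow> functional l (shuffle_word u v) = counit u * l v + l u * counit v"
  shows "com_prelie_subalgebra s f (annihilator s L)"
proof -
  have "functional l (bilin_ext shuffle_word p q) = 0"
    if "l \<in> L" "\<forall>l\<in>L. functional l p = 0" "\<forall>l\<in>L. functional l q = 0" for l p q
    using functional_bilin_ext[of l shuffle_word counit l l counit p q] assms(2) that by simp
  then show ?thesis
    using assms(1) unfolding com_prelie_subalgebra_def
    by (auto simp: annihilator_def tshuffle_tensor_of intro!: imageI)
qed

lemma tensor_alg_eq_annihilator: "tensor_alg s = annihilator s {}"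
  by (auto simp: tensor_alg_eq annihilator_def)

lemma tensor_alg_plus_eq_annihilator: "tensor_alg_plus s = annihilator s {counit}"
  by (auto simp: tensor_alg_plus_def annihilator_def functional_counit in_keys_iff)

lemma com_prelie_subalgebra_tensor_alg:
  assumes "Vector_Spaces.linear s s f"
  shows "com_prelie_subalgebra s f (tensor_alg s)"
  unfolding tensor_alg_eq_annihilator
  by (intro com_prelie_subalgebra_annihilator prelie_subalgebra_annihilator assms) auto

text \<open>
  The counit is multiplicative for the shuffle product rather than a derivation, so its kernel is
  closed under shuffles because one factor alone suffices.
\<close>

lemma com_prelie_subalgebra_tensor_alg_plus:
  assumes "Vector_Spaces.linear s s f"
  shows "com_prelie_subalgebra s f (tensor_alg_plus s)"
proof -
  have "prelie_subalgebra s f (annihilator s {counit})"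
    by (intro prelie_subalgebra_annihilator assms) (auto simp: counit_bullet)
  moreover have "functional counit (bilin_ext shuffle_word p q) = 0"
    if "functional counit p = 0" for p q :: "'b list \<Rightarrow>\<^sub>0 'a"
    using functional_bilin_ext[of counit shuffle_word counit counit "\<lambda>_. 0" "\<lambda>_. 0" p q] that
    by (simp add: counit_shuffle)
  ultimately show ?thesis
    unfolding com_prelie_subalgebra_def tensor_alg_plus_eq_annihilator
    by (auto simp: annihilator_def tshuffle_tensor_of intro!: imageI)
qed

section \<open>Obstructions to generation\<close>

lemma separating_linear_form:
  fixes s :: "'k::field \<Rightarrow> 'v::ab_group_add \<Rightarrow> 'v"
  assumes "vector_space s" "module.subspace s U" "z \<notin> U"
  obtains \<phi> where "\<And>x y a b. \<phi> (s a x + s b y) = a * \<phi> x + b * \<phi> y"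
    "\<And>u. u \<in> U \<Longrightarrow> \<phi> u = 0" "\<phi> z = 1"
proof -
  interpret vector_space s by fact
  obtain B where B: "B \<subseteq> U" "independent B" "U \<subseteq> span B"
    using maximal_independent_subset[of U] by blast
  \<comment> \<open>the coordinate along \<open>z\<close> in a basis extending one of \<open>U\<close>\<close>
  then have spanB: "span B = U" using assms(2) by (meson span_minimal subset_antisym)
  then have "independent (insert z B)" using B(2) assms(3) by (simp add: independent_insert)
  then have ind: "independent (extend_basis (insert z B))"
    and sub: "insert z B \<subseteq> extend_basis (insert z B)"
    and full: "span (extend_basis (insert z B)) = UNIV"
    using independent_extend_basis extend_basis_superset span_extend_basis by blast+
  define \<phi> where "\<phi> x = representation (extend_basis (insert z B)) x z" for x
  have "\<phi> (s a x + s b y) = a * \<phi> x + b * \<phi> y" for a b x y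
    by (simp add: \<phi>_def representation_add[OF ind] representation_scale[OF ind] full)
  moreover have "\<phi> u = 0" if "u \<in> U" for u
  proof -
    have "representation (extend_basis (insert z B)) u = representation B u"
      using representation_extend[OF ind, of u B] sub that spanB by auto
    moreover have "z \<notin> B" using B(1) assms(3) by blast
    ultimately show ?thesis unfolding \<phi>_def using representation_ne_zero by fastforce
  qed
  moreover have "\<phi> z = 1"
    using sub by (simp add: \<phi>_def representation_basis[OF ind])
  ultimately show thesis by (rule that)
qed

lemma codimension_le_1_iff:
  fixes s :: "'k::field \<Rightarrow> 'v::ab_group_add \<Rightarrow> 'v"
  assumes "vector_space s" "module.subspace s U"
  shows "codimension s U \<le> 1 \<longleftrightarrow> (\<exists>z. module.span s (insert z U) = UNIV)"
proof -
  interpret vector_space s by fact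
  let ?C = "{enat (card B) | B. finite B \<and> quotient_basis s U B}"
  show ?thesis
  proof
    assume le: "codimension s U \<le> 1"
    then have "?C \<noteq> {}" by (auto simp: codimension_def Inf_enat_def split: if_splits)
    then have "Inf ?C \<in> ?C" by (meson wellorder_InfI ex_in_conv)
    then obtain B where B: "finite B" "quotient_basis s U B" "enat (card B) = codimension s U"
      by (auto simp: codimension_def)
    with le have "card B \<le> 1" by (metis enat_ord_simps(1) one_enat_def)
    then obtain z where "B \<subseteq> {z}"
      using B(1) by (metis card_le_Suc0_iff_eq One_nat_def subsetI insertI1)
    then have "span (B \<union> U) \<subseteq> span (insert z U)" by (intro span_mono) auto
    with B(2) show "\<exists>z. span (insert z U) = UNIV" by (auto simp: quotient_basis_def)
  next
    assume "\<exists>z. span (insert z U) = UNIV"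
    then obtain z where z: "span (insert z U) = UNIV" ..
    have "\<exists>B. finite B \<and> quotient_basis s U B \<and> card B \<le> 1"
    proof (cases "z \<in> U")
      case True
      then have "quotient_basis s U {}"
        using z subspace_0[OF assms(2)] by (simp add: quotient_basis_def insert_absorb independent_empty)
      then show ?thesis by (intro exI[of _ "{}"]) simp
    next
      case False
      have "x = 0" if "x \<in> span {z}" "x \<in> U" for x
      proof (rule ccontr)
        assume "x \<noteq> 0"
        from that(1) obtain c where c: "x = s c z" by (auto simp: span_singleton)
        with \<open>x \<noteq> 0\<close> have "z = s (inverse c) x" by (cases "c = 0") auto
        then show False using subspace_scale[OF assms(2) that(2)] False by metis
      qed
      then have "quotient_basis s U {z}"
        using z False subspace_0[OF assms(2)] by (auto simp: quotient_basis_def span_zero)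
      then show ?thesis by (intro exI[of _ "{z}"]) simp
    qed
    then obtain B where "finite B" "quotient_basis s U B" "card B \<le> 1" by blast
    then have "Inf ?C \<le> enat (card B)" by (intro Inf_lower) blast
    also have "\<dots> \<le> 1" using \<open>card B \<le> 1\<close> by (simp add: one_enat_def)
    finally show "codimension s U \<le> 1" by (simp add: codimension_def)
  qed
qed

lemma unit_plus_letters_eq:
  "unit_plus_letters s W
    = {tensor_of s (Poly_Mapping.single [] c + Poly_Mapping.single [x] 1) | c x. x \<in> W}"
  by (simp add: unit_plus_letters_def word_def tscale_tensor_of tadd_tensor_of)

lemma unit_plus_letters_subset_pair_annihilator:
  "unit_plus_letters s UNIV \<subseteq> annihilator s {pair_form \<beta>}"
  by (auto simp: unit_plus_letters_eq annihilator_def functional_add intro!: imageI)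

text \<open>
  The form \<open>\<phi> \<otimes> \<phi>\<close>, with \<open>\<phi>\<close> vanishing on \<open>f(V)\<close>, kills all products \<open>a \<bullet> b\<close>. The set spanned by
  all letters and the empty word contains the other generating sets, so the same subalgebra obstructs
  generation by each of them.
\<close>

lemma proper_prelie_subalgebra:
  assumes lin: "Vector_Spaces.linear s s f" and "range f \<noteq> UNIV"
  shows "\<exists>S w. prelie_subalgebra s f S \<and> unit_plus_letters s UNIV \<subseteq> S
    \<and> w \<noteq> [] \<and> word s w \<notin> S"
proof -
  interpret f: Vector_Spaces.linear s s f by fact
  obtain z where z: "z \<notin> range f" using assms(2) by blast
  obtain \<phi> where \<phi>: "\<And>x y a b. \<phi> (s a x + s b y) = a * \<phi> x + b * \<phi> y"
      "\<And>u. u \<in> range f \<Longrightarrow> \<phi> u = 0" "\<phi> z = 1"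
    using separating_linear_form[OF f.vs1.vector_space_axioms
        f.subspace_image[OF f.vs1.subspace_UNIV] z] by blast
  define \<beta> where "\<beta> x y = \<phi> x * \<phi> y" for x y
  have ml: "multilinear_form s (pair_form \<beta>)"
    by (rule multilinear_pair_form) (simp_all add: \<beta>_def \<phi>(1) algebra_simps)
  have "prelie_subalgebra s f (annihilator s {pair_form \<beta>})"
    by (rule prelie_subalgebra_annihilator[OF lin]) (auto simp: pair_form_bullet \<beta>_def \<phi>(2))
  moreover have "word s [z, z] \<notin> annihilator s {pair_form \<beta>}"
    by (subst word_def, subst tensor_of_in_annihilator_iff) (simp_all add: ml \<beta>_def \<phi>(3))
  ultimately show ?thesis using unit_plus_letters_subset_pair_annihilator by blast
qed

text \<open>
  Codimension at least two leaves room for two forms \<open>\<phi>\<close> and \<open>\<psi>\<close> vanishing on \<open>f(V)\<close> whose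
  antisymmetrised product is nonzero; being alternating, it survives shuffles of letters.
\<close>

lemma proper_com_prelie_subalgebra:
  assumes lin: "Vector_Spaces.linear s s f" and "\<not> codimension s (range f) \<le> 1"
  shows "\<exists>S w. com_prelie_subalgebra s f S \<and> unit_plus_letters s UNIV \<subseteq> S
    \<and> w \<noteq> [] \<and> word s w \<notin> S"
proof -
  interpret f: Vector_Spaces.linear s s f by fact
  note vs = f.vs1.vector_space_axioms
  have sub: "f.vs1.subspace (range f)" by (rule f.subspace_image[OF f.vs1.subspace_UNIV])
  have nspan: "f.vs1.span (insert z (range f)) \<noteq> UNIV" for z
    using assms(2) codimension_le_1_iff[OF vs sub] by blast
  have "f.vs1.span (range f) = range f" using sub by (simp add: f.vs1.span_eq_iff)
  with nspan[of "f 0"] obtain x where x: "x \<notin> range f" by (auto simp: insert_absorb)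
  obtain y where y: "y \<notin> f.vs1.span (insert x (range f))" using nspan[of x] by blast
  obtain \<phi> where \<phi>: "\<And>x y a b. \<phi> (s a x + s b y) = a * \<phi> x + b * \<phi> y"
      "\<And>u. u \<in> range f \<Longrightarrow> \<phi> u = 0" "\<phi> x = 1"
    using separating_linear_form[OF vs sub x] by blast
  \<comment> \<open>since \<open>\<psi>\<close> also kills \<open>x\<close>, the value on \<open>xy\<close> is \<open>1\<close> whatever \<open>\<phi> y\<close> is\<close>
  obtain \<psi> where \<psi>: "\<And>x y a b. \<psi> (s a x + s b y) = a * \<psi> x + b * \<psi> y"
      "\<And>u. u \<in> f.vs1.span (insert x (range f)) \<Longrightarrow> \<psi> u = 0" "\<psi> y = 1"
    using separating_linear_form[OF vs f.vs1.subspace_span y] by blast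
  have \<psi>_f: "\<psi> (f u) = 0" for u by (rule \<psi>(2)) (simp add: f.vs1.span_base)
  have \<psi>_x: "\<psi> x = 0" by (rule \<psi>(2)) (simp add: f.vs1.span_base)
  define \<beta> where "\<beta> u v = \<phi> u * \<psi> v - \<psi> u * \<phi> v" for u v
  have ml: "multilinear_form s (pair_form \<beta>)"
    by (rule multilinear_pair_form) (simp_all add: \<beta>_def \<phi>(1) \<psi>(1) algebra_simps)
  have "prelie_subalgebra s f (annihilator s {pair_form \<beta>})"
    by (rule prelie_subalgebra_annihilator[OF lin]) (auto simp: pair_form_bullet \<beta>_def \<phi>(2) \<psi>_f)
  then have "com_prelie_subalgebra s f (annihilator s {pair_form \<beta>})"
    by (rule com_prelie_subalgebra_annihilator) (auto simp: pair_form_shuffle \<beta>_def)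
  moreover have "word s [x, y] \<notin> annihilator s {pair_form \<beta>}"
    by (subst word_def, subst tensor_of_in_annihilator_iff) (simp_all add: ml \<beta>_def \<phi>(3) \<psi>(3) \<psi>_x)
  ultimately show ?thesis using unit_plus_letters_subset_pair_annihilator by blast
qed

lemma image_stable_closure:
  assumes "Vector_Spaces.linear s s f" "x \<in> stable_closure s f W"
  shows "f x \<in> stable_closure s f W"
proof -
  interpret f: Vector_Spaces.linear s s f by fact
  have "f ` (\<Union>k. (f ^^ k) ` W) \<subseteq> (\<Union>k. (f ^^ k) ` W)"
    by clarsimp (metis funpow.simps(2) o_apply imageI)
  then have "f ` f.vs1.span (\<Union>k. (f ^^ k) ` W) \<subseteq> f.vs1.span (\<Union>k. (f ^^ k) ` W)"
    unfolding f.span_image[symmetric] by (rule f.vs1.span_mono)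
  with assms(2) show ?thesis by (auto simp: stable_closure_def)
qed

text \<open>
  Tensors whose component of degree one lies in the stable closure \<open>U\<close> form a subalgebra. Describing
  this condition by all linear forms vanishing on \<open>U\<close> makes it an annihilator; the set of these forms
  is stable under composition with \<open>f\<close> because \<open>U\<close> is stable under \<open>f\<close>.
\<close>

lemma proper_subalgebra_stable_closure:
  assumes lin: "Vector_Spaces.linear s s f" and "stable_closure s f W \<noteq> UNIV"
  shows "\<exists>S w. com_prelie_subalgebra s f S \<and> unit_plus_letters s W \<subseteq> S
    \<and> w \<noteq> [] \<and> word s w \<notin> S"
proof -
  interpret f: Vector_Spaces.linear s s f by fact
  define U where "U = stable_closure s f W"
  define L where "L = letter_form ` {\<phi>. (\<forall>x y a b. \<phi> (s a x + s b y) = a * \<phi> x + b * \<phi> y)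
    \<and> (\<forall>u\<in>U. \<phi> u = 0)}"
  have ml: "multilinear_form s l" if "l \<in> L" for l
    using that by (auto simp: L_def intro: multilinear_letter_form)
  have "prelie_subalgebra s f (annihilator s L)"
  proof (rule prelie_subalgebra_annihilator[OF lin])
    fix l assume "l \<in> L"
    then obtain \<phi> where \<phi>: "l = letter_form \<phi>"
        "\<And>x y a b. \<phi> (s a x + s b y) = a * \<phi> x + b * \<phi> y" "\<And>u. u \<in> U \<Longrightarrow> \<phi> u = 0"
      by (auto simp: L_def)
    have "letter_form (\<lambda>x. \<phi> (f x)) \<in> L"
      using \<phi>(2,3) image_stable_closure[OF lin]
      by (auto simp: L_def U_def f.add f.scale intro!: imageI)
    then show "\<exists>l'\<in>insert (\<lambda>_. 0) L.
        \<forall>u v. functional l (bullet_word f u v) = l' u * counit v"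
      using letter_form_bullet[of \<phi> f] \<phi>(1) by blast
  qed
  then have "com_prelie_subalgebra s f (annihilator s L)"
    by (rule com_prelie_subalgebra_annihilator) (auto simp: L_def letter_form_shuffle)
  moreover have "W \<subseteq> U"
    unfolding U_def stable_closure_def
    by (auto intro!: f.vs1.span_base exI[of _ 0])
  then have "unit_plus_letters s W \<subseteq> annihilator s L"
    by (auto simp: unit_plus_letters_eq tensor_of_in_annihilator_iff[OF ml] functional_add)
      (auto simp: L_def)
  moreover have "\<exists>z. word s [z] \<notin> annihilator s L"
  proof -
    obtain z where z: "z \<notin> U" using assms(2) by (auto simp: U_def)
    have "f.vs1.subspace U" by (simp add: U_def stable_closure_def)
    then obtain \<phi> where \<phi>: "\<And>x y a b. \<phi> (s a x + s b y) = a * \<phi> x + b * \<phi> y"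
        "\<And>u. u \<in> U \<Longrightarrow> \<phi> u = 0" "\<phi> z = 1"
      using separating_linear_form[OF f.vs1.vector_space_axioms _ z] by blast
    then have "letter_form \<phi> \<in> L" by (auto simp: L_def)
    with \<phi>(3) have "word s [z] \<notin> annihilator s L"
      by (auto simp: word_def tensor_of_in_annihilator_iff[OF ml] intro!: bexI[of _ "letter_form \<phi>"])
    then show ?thesis ..
  qed
  ultimately show ?thesis by blast
qed

section \<open>Generating all words\<close>

lemma tensor_of_lin_ext_in:
  assumes S: "tensor_subspace s S"
    and g: "\<And>w. w \<in> Poly_Mapping.keys p \<Longrightarrow> tensor_of s (g w) \<in> S"
  shows "tensor_of s (lin_ext g p) \<in> S"
proof -
  have "tensor_of s (\<Sum>w\<in>A. pscale (Poly_Mapping.lookup p w) (g w)) \<in> S"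
    if "finite A" "A \<subseteq> Poly_Mapping.keys p" for A
    using that
  proof (induction A rule: finite_induct)
    case empty
    show ?case using S by (simp add: tensor_subspace_def)
  next
    case (insert w A)
    then show ?case
      using S g[of w]
      by (simp add: tadd_tensor_of[symmetric] tscale_tensor_of[symmetric] tensor_subspace_def)
  qed
  then show ?thesis by (simp add: lin_ext_def)
qed

lemma lookup_lin_ext:
  "Poly_Mapping.lookup (lin_ext g p) v = functional (\<lambda>w. Poly_Mapping.lookup (g w) v) p"
  by (simp add: lin_ext_def functional_def lookup_sum)

lemma lin_ext_lin_ext: "lin_ext g (lin_ext h p) = lin_ext (\<lambda>w. lin_ext g (h w)) p"
  by (rule poly_mapping_eqI) (simp add: lookup_lin_ext functional_lin_ext)

lemma lin_ext_words: "lin_ext (\<lambda>w. Poly_Mapping.single w 1) p = p"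
proof (rule poly_mapping_eqI)
  fix w
  have "functional (\<lambda>v. if v = w then 1 else 0) p = Poly_Mapping.lookup p w"
    by (subst functional_superset[of "insert w (Poly_Mapping.keys p)"])
      (auto simp: sum.insert_remove)
  then show "Poly_Mapping.lookup (lin_ext (\<lambda>w. Poly_Mapping.single w 1) p) w = Poly_Mapping.lookup p w"
    by (simp add: lookup_lin_ext lookup_single when_def)
qed

lemma tensor_of_in:
  assumes "tensor_subspace s S" "\<And>w. w \<in> Poly_Mapping.keys p \<Longrightarrow> word s w \<in> S"
  shows "tensor_of s p \<in> S"
  using tensor_of_lin_ext_in[OF assms(1), of p "\<lambda>w. Poly_Mapping.single w 1"] assms(2)
  by (simp add: word_def lin_ext_words)

lemma word_linear_comb:
  "word s (u @ (s a x + s b y) # v)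
    = tadd s (tscale s a (word s (u @ x # v))) (tscale s b (word s (u @ y # v)))"
  unfolding word_def tscale_tensor_of tadd_tensor_of tensor_of_eq_iff
  using single_in_relations[of u s a x b y v] by (simp add: algebra_simps)

lemma word_linear_comb_in:
  assumes "tensor_subspace s S" "word s (u @ x # v) \<in> S" "word s (u @ y # v) \<in> S"
  shows "word s (u @ (s a x + s b y) # v) \<in> S"
  using assms by (simp add: word_linear_comb tensor_subspace_def)

text \<open>
  The basic production step, \<open>x \<bullet> w = f(x) w\<close>.
\<close>

lemma word_image_Cons_in:
  assumes "Vector_Spaces.linear s s f" "prelie_subalgebra s f S"
    and "word s [x] \<in> S" "word s w \<in> S"
  shows "word s (f x # w) \<in> S"
proof -
  have "tbullet s f (word s [x]) (word s w) = word s (f x # w)"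
    unfolding word_def tbullet_tensor_of[OF assms(1)]
    by (simp add: bilin_ext_def prepend_def)
  then show ?thesis using assms(2-4) by (metis prelie_subalgebra_def)
qed

lemma words_in_prelie_subalgebra:
  assumes "Vector_Spaces.linear s s f" "prelie_subalgebra s f S"
    and "\<And>x. word s [x] \<in> S" "range f = UNIV" "w \<noteq> []"
  shows "word s w \<in> S"
  using assms(5)
proof (induction w rule: list_nonempty_induct)
  case (single x)
  show ?case by (rule assms(3))
next
  case (cons y w)
  obtain x where "y = f x" using assms(4) by (metis rangeE UNIV_I)
  then show ?case using word_image_Cons_in[OF assms(1,2,3) cons(2)] by simp
qed

lemma keys_lin_ext:
  assumes "w \<in> Poly_Mapping.keys (lin_ext g p)"
  obtains v where "v \<in> Poly_Mapping.keys p" "w \<in> Poly_Mapping.keys (g v)"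
proof -
  have "(\<Sum>v\<in>Poly_Mapping.keys p. Poly_Mapping.lookup p v * Poly_Mapping.lookup (g v) w) \<noteq> 0"
    using assms by (simp add: in_keys_iff lookup_lin_ext functional_def)
  then obtain v where "v \<in> Poly_Mapping.keys p"
      "Poly_Mapping.lookup p v * Poly_Mapping.lookup (g v) w \<noteq> 0"
    by (rule sum.not_neutral_contains_not_neutral)
  then show thesis using that by (auto simp: in_keys_iff)
qed

lemma length_prepend:
  assumes "w \<in> Poly_Mapping.keys (prepend x p)" "\<And>w. w \<in> Poly_Mapping.keys p \<Longrightarrow> length w = n"
  shows "length w = Suc n"
  using assms(1) unfolding prepend_def
  by (rule keys_lin_ext) (use assms(2) in \<open>auto split: if_splits\<close>)

lemma length_shuffle_word:
  assumes "w \<in> Poly_Mapping.keys (shuffle_word u v :: 'v list \<Rightarrow>\<^sub>0 'k::field)"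
  shows "length w = length u + length v"
  using assms
proof (induction u v arbitrary: w rule: shuffle_word.induct)
  case (3 x u y v)
  from 3(3) have "w \<in> Poly_Mapping.keys (prepend x (shuffle_word u (y # v) :: 'v list \<Rightarrow>\<^sub>0 'k))
      \<or> w \<in> Poly_Mapping.keys (prepend y (shuffle_word (x # u) v :: 'v list \<Rightarrow>\<^sub>0 'k))"
    using subsetD[OF Poly_Mapping.keys_add 3(3)[unfolded shuffle_word.simps]] by simp
  then show ?case
  proof
    assume "w \<in> Poly_Mapping.keys (prepend x (shuffle_word u (y # v) :: 'v list \<Rightarrow>\<^sub>0 'k))"
    from length_prepend[OF this 3(1)] show ?case by simp
  next
    assume "w \<in> Poly_Mapping.keys (prepend y (shuffle_word (x # u) v :: 'v list \<Rightarrow>\<^sub>0 'k))"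
    from length_prepend[OF this 3(2)] show ?case by simp
  qed
qed auto

lemma shuffle_letter_replicate:
  "shuffle_word [z] (replicate k z) = Poly_Mapping.single (replicate (Suc k) z) (of_nat (Suc k))"
  by (induction k) (simp_all add: prepend_def flip: single_add)

text \<open>
  Inserting \<open>z\<close> into \<open>z^k y w\<close>: the \<open>k + 1\<close> positions before \<open>y\<close> all give the same word
  \<open>z^{k+1} y w\<close>, and the positions after \<open>y\<close> keep the prefix \<open>z^k y\<close>.
\<close>

lemma shuffle_letter_replicate_Cons:
  "(shuffle_word [z] (replicate k z @ y # w) :: 'a list \<Rightarrow>\<^sub>0 'b::field)
    = Poly_Mapping.single (replicate (Suc k) z @ y # w) (of_nat (Suc k))
      + lin_ext (\<lambda>v. Poly_Mapping.single (replicate k z @ y # v) 1) (shuffle_word [z] w)"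
proof (induction k)
  case 0
  show ?case by (simp add: prepend_def)
next
  case (Suc k)
  have "(shuffle_word [z] (replicate (Suc k) z @ y # w) :: 'a list \<Rightarrow>\<^sub>0 'b)
    = Poly_Mapping.single (replicate (Suc (Suc k)) z @ y # w) 1
      + prepend z (shuffle_word [z] (replicate k z @ y # w))"
    by (simp add: prepend_def)
  also have "\<dots> = Poly_Mapping.single (replicate (Suc (Suc k)) z @ y # w) (of_nat (Suc (Suc k)))
      + lin_ext (\<lambda>v. Poly_Mapping.single (replicate (Suc k) z @ y # v) 1) (shuffle_word [z] w)"
    unfolding Suc
    by (simp add: prepend_def lin_ext_add lin_ext_lin_ext flip: single_add add.assoc)
  finally show ?case .
qed

lemma word_in_of_sum:
  assumes S: "tensor_subspace s S" and "tensor_of s (Poly_Mapping.single w c + q) \<in> S"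
    and "tensor_of s q \<in> S" "c \<noteq> 0"
  shows "word s w \<in> S"
proof -
  have "tscale s (inverse c) (tadd s (tensor_of s (Poly_Mapping.single w c + q))
      (tscale s (- 1) (tensor_of s q))) \<in> S"
    using assms(1-3) by (simp add: tensor_subspace_def)
  moreover have "pscale (inverse c) (Poly_Mapping.single w c + q + pscale (- 1) q)
      = Poly_Mapping.single w 1"
    using \<open>c \<noteq> 0\<close> by (intro poly_mapping_eqI) (simp add: lookup_add lookup_single when_def)
  ultimately show ?thesis by (simp add: word_def tscale_tensor_of tadd_tensor_of)
qed

text \<open>
  Induction on the length. For a fixed length, the words \<open>z^k f(x) w\<close> are obtained by induction on \<open>k\<close>
  by solving the identity for \<open>z \<squnion> z^k f(x) w\<close> for its leading term. Since every letter is a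
  combination of \<open>z\<close> and some \<open>f(x)\<close>, expanding an arbitrary word from the left until the first
  letter \<open>f(x)\<close> leaves only such words and the pure power of \<open>z\<close>.
\<close>

lemma words_in_com_prelie_subalgebra:
  fixes s :: "'k::field_char_0 \<Rightarrow> 'v::ab_group_add \<Rightarrow> 'v"
  assumes lin: "Vector_Spaces.linear s s f" and com: "com_prelie_subalgebra s f S"
    and letters: "\<And>x. word s [x] \<in> S"
    and span: "module.span s (insert z (range f)) = UNIV" and "w \<noteq> []"
  shows "word s w \<in> S"
proof -
  interpret f: Vector_Spaces.linear s s f by fact
  have pre: "prelie_subalgebra s f S" and sub: "tensor_subspace s S"
    using com by (simp_all add: com_prelie_subalgebra_def prelie_subalgebra_def)
  have shuffle: "tensor_of s (shuffle_word u v) \<in> S" if "word s u \<in> S" "word s v \<in> S" for u v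
  proof -
    have "tshuffle s (word s u) (word s v) \<in> S"
      using com that by (simp add: com_prelie_subalgebra_def)
    then show ?thesis by (simp add: word_def tshuffle_tensor_of bilin_ext_def)
  qed
  have "word s w \<in> S" if "length w = Suc n" for w n
    using that
  proof (induction n arbitrary: w)
    case 0
    then show ?case using letters by (auto simp: length_Suc_conv)
  next
    case (Suc n)
    have block: "word s (replicate k z @ f x # w) \<in> S" if "k + length w = Suc n" for k x w
      using that
    proof (induction k arbitrary: w)
      case 0
      then show ?case
        using word_image_Cons_in[OF lin pre letters Suc.IH] by simp
    next
      case (Suc k)
      let ?rest = "lin_ext (\<lambda>v. Poly_Mapping.single (replicate k z @ f x # v) 1) (shuffle_word [z] w)"
      have "tensor_of s ?rest \<in> S"
      proof (rule tensor_of_lin_ext_in[OF sub])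
        fix v assume "v \<in> Poly_Mapping.keys (shuffle_word [z] w :: 'v list \<Rightarrow>\<^sub>0 'k)"
        then have "k + length v = Suc n"
          using length_shuffle_word Suc.prems by fastforce
        then show "tensor_of s (Poly_Mapping.single (replicate k z @ f x # v) 1) \<in> S"
          using Suc.IH by (simp add: word_def)
      qed
      moreover have "word s (replicate k z @ f x # w) \<in> S"
        using \<open>\<And>w. length w = Suc n \<Longrightarrow> word s w \<in> S\<close> Suc.prems by simp
      then have "tensor_of s (shuffle_word [z] (replicate k z @ f x # w)) \<in> S"
        by (rule shuffle[OF letters])
      ultimately show ?case
        unfolding shuffle_letter_replicate_Cons
        by (intro word_in_of_sum[OF sub, where q = ?rest and c = "of_nat (Suc k)"])
          (simp_all del: of_nat_Suc)
    qed
    have "word s (replicate (Suc n) z) \<in> S" by (rule Suc.IH) simp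
    then have "tensor_of s (Poly_Mapping.single (replicate (Suc (Suc n)) z) (of_nat (Suc (Suc n)))) \<in> S"
      using shuffle[OF letters, of "replicate (Suc n) z" z]
      unfolding shuffle_letter_replicate by simp
    then have power: "word s (replicate (Suc (Suc n)) z) \<in> S"
      using sub by (intro word_in_of_sum[OF sub, where q = 0 and c = "of_nat (Suc (Suc n))"])
        (simp_all add: tensor_subspace_def del: of_nat_Suc)
    \<comment> \<open>the prefix of letters already replaced by \<open>z\<close> grows, the rest of the word shrinks\<close>
    have "word s (replicate k z @ w) \<in> S" if "k + length w = Suc (Suc n)" for k w
      using that
    proof (induction w arbitrary: k)
      case Nil
      then show ?case using power by simp
    next
      case (Cons y w)
      have "y \<in> f.vs1.span (insert z (range f))" by (simp add: span)
      moreover have "f.vs1.span (range f) = range f"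
        using f.subspace_image[OF f.vs1.subspace_UNIV] by (simp add: f.vs1.span_eq_iff)
      ultimately obtain c x where "y - s c z = f x"
        by (auto simp: f.vs1.span_breakdown_eq)
      then have y: "y = s c z + s 1 (f x)" by (simp add: algebra_simps)
      have "replicate k z @ z # w = replicate (Suc k) z @ w"
        by (simp add: replicate_app_Cons_same)
      then have "word s (replicate k z @ z # w) \<in> S"
        using Cons.IH[of "Suc k"] Cons.prems by (simp only: list.size add_Suc add_Suc_right)
      moreover have "word s (replicate k z @ f x # w) \<in> S"
        using Cons.prems by (intro block) simp
      ultimately show ?case unfolding y by (rule word_linear_comb_in[OF sub])
    qed
    from this[of 0 w] Suc.prems show ?case by simp
  qed
  with \<open>w \<noteq> []\<close> show ?thesis by (metis length_0_conv not0_implies_Suc)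
qed

text \<open>
  With the empty word at hand, \<open>x \<bullet> \<emptyset> = f(x)\<close> lets the letters in a subalgebra absorb \<open>f\<close>, hence
  the whole stable closure.
\<close>

lemma unit_and_letters_in_prelie_subalgebra:
  assumes lin: "Vector_Spaces.linear s s f" and pre: "prelie_subalgebra s f S"
    and "module.subspace s W" "unit_plus_letters s W \<subseteq> S" "stable_closure s f W = UNIV"
  shows "word s [] \<in> S" "word s [x] \<in> S"
proof -
  interpret f: Vector_Spaces.linear s s f by fact
  have sub: "tensor_subspace s S" using pre by (simp add: prelie_subalgebra_def)
  have gen: "tensor_of s (Poly_Mapping.single [] c + Poly_Mapping.single [x] 1) \<in> S"
    if "x \<in> W" for c x
    using that assms(4) by (auto simp: unit_plus_letters_eq)
  have W: "word s [x] \<in> S" if "x \<in> W" for x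
    using gen[OF that, of 0] by (simp add: word_def)
  have "0 \<in> W" using assms(3) by (rule f.vs1.subspace_0)
  then show unit: "word s [] \<in> S"
    using gen[of 0 1] W[of 0]
    by (intro word_in_of_sum[OF sub, where c = 1 and q = "Poly_Mapping.single [0] 1"])
      (simp_all add: word_def)
  have "word s [(f ^^ k) x] \<in> S" if "x \<in> W" for k x
  proof (induction k)
    case (Suc k)
    then show ?case using word_image_Cons_in[OF lin pre _ unit] by simp
  qed (simp add: W that)
  then have "(\<Union>k. (f ^^ k) ` W) \<subseteq> {x. word s [x] \<in> S}" by blast
  moreover have comb: "word s [s a x + s b y] \<in> S" if "word s [x] \<in> S" "word s [y] \<in> S" for a b x y
    using word_linear_comb_in[OF sub, of "[]"] that by simp
  have "f.vs1.subspace {x. word s [x] \<in> S}"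
    unfolding f.vs1.subspace_def
    using W[OF \<open>0 \<in> W\<close>] comb[of _ _ 1 1] comb[of _ 0 _ 0] by simp
  ultimately have "stable_closure s f W \<subseteq> {x. word s [x] \<in> S}"
    unfolding stable_closure_def by (rule f.vs1.span_minimal)
  then show "word s [x] \<in> S" using assms(5) by blast
qed

section \<open>The generation criteria\<close>

lemma word_in_tensor_alg: "word s w \<in> tensor_alg s"
  by (simp add: word_def tensor_alg_eq)

lemma word_in_tensor_alg_plus: "w \<noteq> [] \<Longrightarrow> word s w \<in> tensor_alg_plus s"
  by (auto simp: word_def tensor_alg_plus_def split: if_splits)

lemma tensor_alg_subset:
  assumes "tensor_subspace s S" "\<And>w. word s w \<in> S"
  shows "tensor_alg s \<subseteq> S"
  using tensor_of_in[OF assms(1)] assms(2) by (auto simp: tensor_alg_eq)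

lemma tensor_alg_plus_subset:
  assumes "tensor_subspace s S" "\<And>w. w \<noteq> [] \<Longrightarrow> word s w \<in> S"
  shows "tensor_alg_plus s \<subseteq> S"
proof
  fix A assume "A \<in> tensor_alg_plus s"
  then obtain p where p: "A = tensor_of s p" "[] \<notin> Poly_Mapping.keys p"
    by (auto simp: tensor_alg_plus_def)
  show "A \<in> S"
    unfolding p(1) by (rule tensor_of_in[OF assms(1)]) (metis assms(2) p(2))
qed

lemma hull_eq_iff:
  assumes "P T" "X \<subseteq> T"
  shows "P hull X = T \<longleftrightarrow> (\<forall>S. P S \<and> X \<subseteq> S \<longrightarrow> T \<subseteq> S)"
  using assms by (auto simp: hull_def)

lemma letters_subset_unit_plus_letters: "letters s W \<subseteq> unit_plus_letters s W"
proof -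
  have "word s [x] = tensor_of s (Poly_Mapping.single [] 0 + Poly_Mapping.single [x] 1)" for x
    by (simp add: word_def)
  then show ?thesis unfolding letters_def unit_plus_letters_eq by blast
qed

lemma unit_plus_letters_mono: "W \<subseteq> W' \<Longrightarrow> unit_plus_letters s W \<subseteq> unit_plus_letters s W'"
  by (auto simp: unit_plus_letters_def)

theorem corollary33:
  fixes scale :: "'k::field_char_0 \<Rightarrow> 'v::ab_group_add \<Rightarrow> 'v"
    and f :: "'v \<Rightarrow> 'v"
  assumes "vector_space scale"
    and "Vector_Spaces.linear scale scale f"
  shows "(generates_prelie scale f (letters scale UNIV) (tensor_alg_plus scale)
            \<longleftrightarrow> f ` UNIV = UNIV)
       \<and> (generates_com_prelie scale f (letters scale UNIV) (tensor_alg_plus scale)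
            \<longleftrightarrow> codimension scale (f ` UNIV) \<le> 1)
       \<and> (\<forall>W. module.subspace scale W \<longrightarrow>
            (generates_prelie scale f (unit_plus_letters scale W) (tensor_alg scale)
               \<longleftrightarrow> stable_closure scale f W = UNIV \<and> f ` UNIV = UNIV)
          \<and> (generates_com_prelie scale f (unit_plus_letters scale W) (tensor_alg scale)
               \<longleftrightarrow> stable_closure scale f W = UNIV \<and> codimension scale (f ` UNIV) \<le> 1))"
proof (intro conjI allI impI)
  interpret f: Vector_Spaces.linear scale scale f by fact
  note lin = assms(2)
  let ?T = "tensor_alg scale" and ?P = "tensor_alg_plus scale"
  let ?V = "letters scale UNIV" and ?X = "unit_plus_letters scale"
  have codim: "codimension scale (range f) \<le> 1
      \<longleftrightarrow> (\<exists>z. f.vs1.span (insert z (range f)) = UNIV)"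
    by (rule codimension_le_1_iff[OF assms(1) f.subspace_image[OF f.vs1.subspace_UNIV]])
  have preD: "tensor_subspace scale S" if "prelie_subalgebra scale f S" for S
    using that by (simp add: prelie_subalgebra_def)
  have comD: "prelie_subalgebra scale f S" if "com_prelie_subalgebra scale f S" for S
    using that by (simp add: com_prelie_subalgebra_def)
  have com_T: "com_prelie_subalgebra scale f ?T" and com_P: "com_prelie_subalgebra scale f ?P"
    using com_prelie_subalgebra_tensor_alg com_prelie_subalgebra_tensor_alg_plus lin by blast+
  have V_P: "?V \<subseteq> ?P" using word_in_tensor_alg_plus by (fastforce simp: letters_def)
  have X_T: "?X W \<subseteq> ?T" for W by (auto simp: unit_plus_letters_eq tensor_alg_eq)
  have V_X: "?V \<subseteq> ?X UNIV" by (rule letters_subset_unit_plus_letters)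
  have X_X: "?X W \<subseteq> ?X UNIV" for W by (rule unit_plus_letters_mono) simp
  have VD: "word scale [x] \<in> S" if "?V \<subseteq> S" for S x
    using that by (auto simp: letters_def)
  note prelie_iff = hull_eq_iff[of "prelie_subalgebra scale f", OF comD]
  note com_iff = hull_eq_iff[of "com_prelie_subalgebra scale f"]

  show "generates_prelie scale f ?V ?P \<longleftrightarrow> range f = UNIV"
    unfolding generates_prelie_def prelie_iff[OF com_P V_P]
  proof
    show "range f = UNIV" if "\<forall>S. prelie_subalgebra scale f S \<and> ?V \<subseteq> S \<longrightarrow> ?P \<subseteq> S"
      using proper_prelie_subalgebra[OF lin] word_in_tensor_alg_plus that V_X by blast
    show "\<forall>S. prelie_subalgebra scale f S \<and> ?V \<subseteq> S \<longrightarrow> ?P \<subseteq> S" if "range f = UNIV"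
      using words_in_prelie_subalgebra[OF lin _ VD that] tensor_alg_plus_subset[OF preD] by blast
  qed
  show "generates_com_prelie scale f ?V ?P \<longleftrightarrow> codimension scale (range f) \<le> 1"
    unfolding generates_com_prelie_def com_iff[OF com_P V_P]
  proof
    show "codimension scale (range f) \<le> 1"
      if "\<forall>S. com_prelie_subalgebra scale f S \<and> ?V \<subseteq> S \<longrightarrow> ?P \<subseteq> S"
      using proper_com_prelie_subalgebra[OF lin] word_in_tensor_alg_plus that V_X by blast
    show "\<forall>S. com_prelie_subalgebra scale f S \<and> ?V \<subseteq> S \<longrightarrow> ?P \<subseteq> S"
      if "codimension scale (range f) \<le> 1"
      using words_in_com_prelie_subalgebra[OF lin _ VD] tensor_alg_plus_subset[OF preD[OF comD]]
        that codim by metis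
  qed
  fix W assume W: "f.vs1.subspace W"
  show "generates_prelie scale f (?X W) ?T \<longleftrightarrow> stable_closure scale f W = UNIV \<and> range f = UNIV"
    unfolding generates_prelie_def prelie_iff[OF com_T X_T]
  proof
    assume *: "\<forall>S. prelie_subalgebra scale f S \<and> ?X W \<subseteq> S \<longrightarrow> ?T \<subseteq> S"
    have "range f = UNIV"
      using proper_prelie_subalgebra[OF lin] word_in_tensor_alg * X_X by blast
    moreover have "stable_closure scale f W = UNIV"
      using proper_subalgebra_stable_closure[OF lin] word_in_tensor_alg * comD by blast
    ultimately show "stable_closure scale f W = UNIV \<and> range f = UNIV" by simp
  next
    assume *: "stable_closure scale f W = UNIV \<and> range f = UNIV"
    have "?T \<subseteq> S" if S: "prelie_subalgebra scale f S" "?X W \<subseteq> S" for S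
    proof (rule tensor_alg_subset[OF preD[OF S(1)]])
      note base = unit_and_letters_in_prelie_subalgebra[OF lin S(1) W S(2) conjunct1[OF *]]
      show "word scale w \<in> S" for w
        using words_in_prelie_subalgebra[OF lin S(1) base(2) conjunct2[OF *]] base(1)
        by (cases "w = []") simp_all
    qed
    then show "\<forall>S. prelie_subalgebra scale f S \<and> ?X W \<subseteq> S \<longrightarrow> ?T \<subseteq> S" by blast
  qed
  show "generates_com_prelie scale f (?X W) ?T
      \<longleftrightarrow> stable_closure scale f W = UNIV \<and> codimension scale (range f) \<le> 1"
    unfolding generates_com_prelie_def com_iff[OF com_T X_T]
  proof
    assume *: "\<forall>S. com_prelie_subalgebra scale f S \<and> ?X W \<subseteq> S \<longrightarrow> ?T \<subseteq> S"
    have "codimension scale (range f) \<le> 1"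
      using proper_com_prelie_subalgebra[OF lin] word_in_tensor_alg * X_X by blast
    moreover have "stable_closure scale f W = UNIV"
      using proper_subalgebra_stable_closure[OF lin] word_in_tensor_alg * by blast
    ultimately show "stable_closure scale f W = UNIV \<and> codimension scale (range f) \<le> 1" by simp
  next
    assume *: "stable_closure scale f W = UNIV \<and> codimension scale (range f) \<le> 1"
    then obtain z where z: "f.vs1.span (insert z (range f)) = UNIV" using codim by blast
    have "?T \<subseteq> S" if S: "com_prelie_subalgebra scale f S" "?X W \<subseteq> S" for S
    proof (rule tensor_alg_subset[OF preD[OF comD[OF S(1)]]])
      note base = unit_and_letters_in_prelie_subalgebra[OF lin comD[OF S(1)] W S(2) conjunct1[OF *]]
      show "word scale w \<in> S" for w
        using words_in_com_prelie_subalgebra[OF lin S(1) base(2) z] base(1)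
        by (cases "w = []") simp_all
    qed
    then show "\<forall>S. com_prelie_subalgebra scale f S \<and> ?X W \<subseteq> S \<longrightarrow> ?T \<subseteq> S" by blast
  qed
qed

end
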